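(* In $L(\mathfrak{sl}_2)^+$ define, for $i\geq 0$, $A^{\uparrow\downarrow}_i=x\otimes(-t)^i$, $B^{\uparrow\downarrow}_i=(-y\otimes t-z\otimes(t-1))(-t)^i$, $\psi^{\uparrow\downarrow}_i=(x\otimes1-z\otimes(t-1))(-t)^{i-1}$. Then: (i) The elements $\{A^{\uparrow\downarrow}_i\}_{i\in\mathbb{N}}$ form a basis for $X^\sigma_{12}\cap O$. (ii) The elements $\{B^{\uparrow\downarrow}_i\}_{i\in\mathbb{N}}$ form a basis for $X^\sigma_{30}\cap O$. (iii) The elements $\{\psi^{\uparrow\downarrow}_{i+1}\}_{i\in\mathbb{N}}$ form a basis for $X^\sigma_{01}\cap O$.
   Context: $\mathbb{F}$ is a field of characteristic zero; $\mathbb{N}=\{0,1,2,\ldots\}$; $\mathbb{I}=\{0,1,2,3\}$; tensor products are over $\mathbb{F}$. The tetrahedron algebra $\boxtimes$ is the Lie algebra over $\mathbb{F}$ with generators $\{x_{ij}\mid i,j\in\mathbb{I},\ i\neq j\}$ and relations: $x_{ij}+x_{ji}=0$ for distinct $i,j$; $[x_{ij},x_{jk}]=2x_{ij}+2x_{jk}$ for mutually distinct $i,j,k$; $[x_{ij},[x_{ij},[x_{ij},x_{kh}]]]=4[x_{ij},x_{kh}]$ for mutually distinct $h,i,j,k$. For distinct $i,j\in\mathbb{I}$, $X_{ij}$ is the subspace of all $\xi\in\boxtimes$ ($x_{ij}$-like elements) with $[x_{ij},\xi]=0$ and $[x_{kh},[x_{kh},[x_{kh},\xi]]]=4[x_{kh},\xi]$,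 where $\{h,i,j,k\}=\mathbb{I}$; $X_{ij}=X_{ji}$. $\mathfrak{sl}_2$ has basis $e,f,h$ with $[h,e]=2e$, $[h,f]=-2f$, $[e,f]=h$, and equitable basis $x=2e-h$, $y=-2f-h$, $z=h$. $\mathcal{A}=\mathbb{F}[t,t^{-1},(t-1)^{-1}]$, $t$ an indeterminate, $t'=1-t^{-1}$, $t''=(1-t)^{-1}$. $L(\mathfrak{sl}_2)^+=\mathfrak{sl}_2\otimes\mathcal{A}$ with $[u\otimes a,v\otimes b]=[u,v]\otimes ab$; it is a right $\mathcal{A}$-module via $(u\otimes a)b=u\otimes ab$. $\sigma:\boxtimes\to L(\mathfrak{sl}_2)^+$ is the (unique) Lie algebra isomorphism with $x_{12}\mapsto x\otimes1$, $x_{23}\mapsto y\otimes1$, $x_{31}\mapsto z\otimes1$, $x_{03}\mapsto y\otimes t+z\otimes(t-1)$, $x_{01}\mapsto z\otimes t'+x\otimes(t'-1)$, $x_{02}\mapsto x\otimes t''+y\otimes(t''-1)$. $X^\sigma_{ij}$ denotes the image of $X_{ij}$ under $\sigma$. The Onsager Lie algebra $O$ (generators $A,B$; relations $[A,[A,[A,B]]]=4[A,B]$, $[B,[B,[B,A]]]=4[B,A]$) is identified with the Lie subalgebra of $L(\mathfrak{sl}_2)^+$ generated by $A=x\otimes1$ and $B=y\otimes t+z\otimes(t-1)$. *)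

theory Defs
  imports "HOL-Computational_Algebra.Computational_Algebra" "HOL-Library.Numeral_Type"
begin

section \<open>Lie algebras over a field\<close>

locale lie_algebra = vector_space scale
  for scale :: "'f::field \<Rightarrow> 'v::ab_group_add \<Rightarrow> 'v" +
  fixes br :: "'v \<Rightarrow> 'v \<Rightarrow> 'v"
  assumes br_add_left: "br (u + v) w = br u w + br v w"
    and br_add_right: "br u (v + w) = br u v + br u w"
    and br_scale_left: "br (scale c u) v = scale c (br u v)"
    and br_scale_right: "br u (scale c v) = scale c (br u v)"
    and br_self: "br u u = 0"
    and jacobi: "br u (br v w) + br v (br w u) + br w (br u v) = 0"

definition lie_iso ::
    "('f::field \<Rightarrow> 'v::ab_group_add \<Rightarrow> 'v) \<Rightarrow> ('v \<Rightarrow> 'v \<Rightarrow> 'v) \<Rightarrow>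
     ('f \<Rightarrow> 'w::ab_group_add \<Rightarrow> 'w) \<Rightarrow> ('w \<Rightarrow> 'w \<Rightarrow> 'w) \<Rightarrow> ('v \<Rightarrow> 'w) \<Rightarrow> bool" where
  "lie_iso s1 br1 s2 br2 \<phi> \<longleftrightarrow>
     Vector_Spaces.linear s1 s2 \<phi> \<and> (\<forall>u v. \<phi> (br1 u v) = br2 (\<phi> u) (\<phi> v)) \<and> bij \<phi>"

definition lie_subalgebra ::
    "('f::field \<Rightarrow> 'v::ab_group_add \<Rightarrow> 'v) \<Rightarrow> ('v \<Rightarrow> 'v \<Rightarrow> 'v) \<Rightarrow> 'v set \<Rightarrow> bool" where
  "lie_subalgebra s br S \<longleftrightarrow> module.subspace s S \<and> (\<forall>u\<in>S. \<forall>v\<in>S. br u v \<in> S)"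

definition lie_subalgebra_generated ::
    "('f::field \<Rightarrow> 'v::ab_group_add \<Rightarrow> 'v) \<Rightarrow> ('v \<Rightarrow> 'v \<Rightarrow> 'v) \<Rightarrow> 'v set \<Rightarrow> 'v set" where
  "lie_subalgebra_generated s br G = \<Inter>{S. lie_subalgebra s br S \<and> G \<subseteq> S}"

definition family_basis ::
    "('f::field \<Rightarrow> 'v::ab_group_add \<Rightarrow> 'v) \<Rightarrow> ('i \<Rightarrow> 'v) \<Rightarrow> 'v set \<Rightarrow> bool" where
  "family_basis s b W \<longleftrightarrow>
     inj b \<and> \<not> module.dependent s (range b) \<and> module.span s (range b) = W"


section \<open>Lie algebras by generators and relations\<close>

datatype ('f, 'g) lie_term =
    Gen 'g
  | Zero
  | Add "('f, 'g) lie_term" "('f, 'g) lie_term"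
  | Scale 'f "('f, 'g) lie_term"
  | Br "('f, 'g) lie_term" "('f, 'g) lie_term"

text \<open>The least congruence that contains the relations \<open>R\<close> and the axioms of a Lie algebra.
  The terms modulo this congruence are the Lie algebra presented by \<open>R\<close>.\<close>

inductive lie_cong ::
    "(('f::field, 'g) lie_term \<Rightarrow> ('f, 'g) lie_term \<Rightarrow> bool) \<Rightarrow>
     ('f, 'g) lie_term \<Rightarrow> ('f, 'g) lie_term \<Rightarrow> bool"
  for R where
  rel: "R p q \<Longrightarrow> lie_cong R p q"
| refl: "lie_cong R p p"
| sym: "lie_cong R p q \<Longrightarrow> lie_cong R q p"
| trans: "lie_cong R p q \<Longrightarrow> lie_cong R q r \<Longrightarrow> lie_cong R p r"
| cong_Add: "lie_cong R p p' \<Longrightarrow> lie_cong R q q' \<Longrightarrow> lie_cong R (Add p q) (Add p' q')"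
| cong_Scale: "lie_cong R p p' \<Longrightarrow> lie_cong R (Scale c p) (Scale c p')"
| cong_Br: "lie_cong R p p' \<Longrightarrow> lie_cong R q q' \<Longrightarrow> lie_cong R (Br p q) (Br p' q')"
| Add_assoc: "lie_cong R (Add (Add p q) r) (Add p (Add q r))"
| Add_commute: "lie_cong R (Add p q) (Add q p)"
| Add_Zero: "lie_cong R (Add Zero p) p"
| Add_inverse: "lie_cong R (Add (Scale (-1) p) p) Zero"
| Scale_Add: "lie_cong R (Scale c (Add p q)) (Add (Scale c p) (Scale c q))"
| add_Scale: "lie_cong R (Scale (c + d) p) (Add (Scale c p) (Scale d p))"
| Scale_Scale: "lie_cong R (Scale c (Scale d p)) (Scale (c * d) p)"
| Scale_one: "lie_cong R (Scale 1 p) p"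
| Br_Add_left: "lie_cong R (Br (Add p q) r) (Add (Br p r) (Br q r))"
| Br_Add_right: "lie_cong R (Br p (Add q r)) (Add (Br p q) (Br p r))"
| Br_Scale_left: "lie_cong R (Br (Scale c p) q) (Scale c (Br p q))"
| Br_Scale_right: "lie_cong R (Br p (Scale c q)) (Scale c (Br p q))"
| Br_self: "lie_cong R (Br p p) Zero"
| Jacobi: "lie_cong R (Add (Add (Br p (Br q r)) (Br q (Br r p))) (Br r (Br p q))) Zero"

lemma lie_cong_equivp: "equivp (lie_cong R)"
  by (intro equivpI reflpI sympI transpI) (blast intro: lie_cong.intros)+


section \<open>The tetrahedron algebra\<close>

text \<open>The index set is the numeral type \<open>4\<close>, with elements \<open>0, 1, 2, 3\<close>
  (as elements of this type, \<open>4 = 0\<close>).  The generators are indexed by all pairs;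
  those with equal indices do not belong to the presentation and are set to zero.\<close>

abbreviation (input) "xgen i j \<equiv> Gen (i, j)"

inductive tet_rel ::
    "('a::field_char_0, 4 \<times> 4) lie_term \<Rightarrow> ('a, 4 \<times> 4) lie_term \<Rightarrow> bool" where
  "tet_rel (xgen i i) Zero"
| "i \<noteq> j \<Longrightarrow> tet_rel (Add (xgen i j) (xgen j i)) Zero"
| "distinct [i, j, k] \<Longrightarrow>
     tet_rel (Br (xgen i j) (xgen j k)) (Add (Scale 2 (xgen i j)) (Scale 2 (xgen j k)))"
| "distinct [h, i, j, k] \<Longrightarrow>
     tet_rel (Br (xgen i j) (Br (xgen i j) (Br (xgen i j) (xgen k h)))) (Scale 4 (Br (xgen i j) (xgen k h)))"

quotient_type (overloaded) 'a tet = "('a::field_char_0, 4 \<times> 4) lie_term" / "lie_cong tet_rel"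
  by (rule lie_cong_equivp)

instantiation tet :: (field_char_0) ab_group_add
begin

lift_definition zero_tet :: "'a tet" is Zero .
lift_definition plus_tet :: "'a tet \<Rightarrow> 'a tet \<Rightarrow> 'a tet" is Add
  by (rule lie_cong.cong_Add)
lift_definition uminus_tet :: "'a tet \<Rightarrow> 'a tet" is "Scale (-1)"
  by (rule lie_cong.cong_Scale)
definition minus_tet :: "'a tet \<Rightarrow> 'a tet \<Rightarrow> 'a tet" where "minus_tet u v = u + - v"

instance
proof
  fix a b c :: "'a tet"
  show "a + b + c = a + (b + c)" by transfer (rule lie_cong.Add_assoc)
  show "a + b = b + a" by transfer (rule lie_cong.Add_commute)
  show "0 + a = a" by transfer (rule lie_cong.Add_Zero)
  show "- a + a = 0" by transfer (rule lie_cong.Add_inverse)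
  show "a - b = a + - b" by (rule minus_tet_def)
qed

end

lift_definition tet_scale :: "'a::field_char_0 \<Rightarrow> 'a tet \<Rightarrow> 'a tet" is Scale
  by (rule lie_cong.cong_Scale)
lift_definition tet_br :: "'a::field_char_0 tet \<Rightarrow> 'a tet \<Rightarrow> 'a tet" is Br
  by (rule lie_cong.cong_Br)
lift_definition tet_x :: "4 \<Rightarrow> 4 \<Rightarrow> 'a::field_char_0 tet" is "\<lambda>i j. xgen i j" .

global_interpretation tet: lie_algebra "tet_scale :: 'a::field_char_0 \<Rightarrow> _" tet_br
proof
  fix c d :: 'a and u v w :: "'a tet"
  show "tet_scale c (u + v) = tet_scale c u + tet_scale c v"
    by transfer (rule lie_cong.Scale_Add)
  show "tet_scale (c + d) u = tet_scale c u + tet_scale d u"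
    by transfer (rule lie_cong.add_Scale)
  show "tet_scale c (tet_scale d u) = tet_scale (c * d) u"
    by transfer (rule lie_cong.Scale_Scale)
  show "tet_scale 1 u = u" by transfer (rule lie_cong.Scale_one)
  show "tet_br (u + v) w = tet_br u w + tet_br v w" by transfer (rule lie_cong.Br_Add_left)
  show "tet_br u (v + w) = tet_br u v + tet_br u w" by transfer (rule lie_cong.Br_Add_right)
  show "tet_br (tet_scale c u) v = tet_scale c (tet_br u v)"
    by transfer (rule lie_cong.Br_Scale_left)
  show "tet_br u (tet_scale c v) = tet_scale c (tet_br u v)"
    by transfer (rule lie_cong.Br_Scale_right)
  show "tet_br u u = 0" by transfer (rule lie_cong.Br_self)
  show "tet_br u (tet_br v w) + tet_br v (tet_br w u) + tet_br w (tet_br u v) = 0"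
    by transfer (rule lie_cong.Jacobi)
qed

definition tet_X :: "4 \<Rightarrow> 4 \<Rightarrow> 'a::field_char_0 tet set" where
  "tet_X i j = {\<xi>. tet_br (tet_x i j) \<xi> = 0 \<and>
     (\<forall>h k. {h, i, j, k} = UNIV \<longrightarrow>
        tet_br (tet_x k h) (tet_br (tet_x k h) (tet_br (tet_x k h) \<xi>))
          = tet_scale 4 (tet_br (tet_x k h) \<xi>))}"


section \<open>The Lie algebra \<open>sl\<^sub>2\<close>\<close>

text \<open>\<open>Sl2 a b c\<close> is \<open>a e + b f + c h\<close>.  The coefficients are taken in an arbitrary commutative
  ring, so that the same type also serves for \<open>sl\<^sub>2\<close> with scalars extended to an algebra.\<close>

datatype 'r sl2 = Sl2 (e_coeff: 'r) (f_coeff: 'r) (h_coeff: 'r)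

instantiation sl2 :: (ab_group_add) ab_group_add
begin

definition "0 = Sl2 0 0 0"
definition "u + v =
  Sl2 (e_coeff u + e_coeff v) (f_coeff u + f_coeff v) (h_coeff u + h_coeff v)"
definition "- u = Sl2 (- e_coeff u) (- f_coeff u) (- h_coeff u)"
definition "u - v =
  Sl2 (e_coeff u - e_coeff v) (f_coeff u - f_coeff v) (h_coeff u - h_coeff v)"

instance
  by standard
    (simp_all add: zero_sl2_def plus_sl2_def uminus_sl2_def minus_sl2_def algebra_simps)

end

lemmas sl2_ops = zero_sl2_def plus_sl2_def uminus_sl2_def minus_sl2_def

definition sl2_scale :: "'r::comm_ring_1 \<Rightarrow> 'r sl2 \<Rightarrow> 'r sl2" where
  "sl2_scale c = map_sl2 ((*) c)"

text \<open>The bilinear alternating bracket with \<open>[h,e] = 2e\<close>, \<open>[h,f] = -2f\<close>, \<open>[e,f] = h\<close>.\<close>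

definition sl2_br :: "'r::comm_ring_1 sl2 \<Rightarrow> 'r sl2 \<Rightarrow> 'r sl2" where
  "sl2_br u v = Sl2
     (2 * (h_coeff u * e_coeff v - e_coeff u * h_coeff v))
     (2 * (f_coeff u * h_coeff v - h_coeff u * f_coeff v))
     (e_coeff u * f_coeff v - f_coeff u * e_coeff v)"

definition sl2_e :: "'r::comm_ring_1 sl2" where "sl2_e = Sl2 1 0 0"
definition sl2_f :: "'r::comm_ring_1 sl2" where "sl2_f = Sl2 0 1 0"
definition sl2_h :: "'r::comm_ring_1 sl2" where "sl2_h = Sl2 0 0 1"

lemma sl2_br_basis:
  "sl2_br sl2_h sl2_e = sl2_scale 2 sl2_e"
  "sl2_br sl2_h sl2_f = sl2_scale (-2) sl2_f"
  "sl2_br sl2_e sl2_f = sl2_h"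
  by (simp_all add: sl2_br_def sl2_scale_def sl2_e_def sl2_f_def sl2_h_def)

lemma sl2_decomp:
  "Sl2 a b c = sl2_scale a sl2_e + sl2_scale b sl2_f + sl2_scale c sl2_h"
  by (simp add: sl2_scale_def sl2_e_def sl2_f_def sl2_h_def sl2_ops)

global_interpretation sl2: lie_algebra "sl2_scale :: 'a::field \<Rightarrow> _" sl2_br
  by standard
    (auto simp: sl2_scale_def sl2_br_def sl2_ops algebra_simps sl2.map_sel intro: sl2.expand)

definition sl2_x :: "'r::comm_ring_1 sl2" where "sl2_x = sl2_scale 2 sl2_e - sl2_h"
definition sl2_y :: "'r::comm_ring_1 sl2" where "sl2_y = sl2_scale (-2) sl2_f - sl2_h"
definition sl2_z :: "'r::comm_ring_1 sl2" where "sl2_z = sl2_h"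


section \<open>The algebra \<open>\<A> = \<bbbF>[t, t\<inverse>, (t-1)\<inverse>]\<close>\<close>

text \<open>\<open>\<A>\<close> is the subring generated by \<open>\<bbbF>\<close>, \<open>t\<close>, \<open>t\<inverse>\<close>, \<open>(t-1)\<inverse>\<close> in the field of rational functions
  in \<open>t\<close>, which is the fraction field of the polynomial ring.\<close>

definition rat_const :: "'a::field_char_0 \<Rightarrow> 'a poly fract" where
  "rat_const c = to_fract [:c:]"

definition rat_t :: "'a::field_char_0 poly fract" where
  "rat_t = to_fract [:0, 1:]"

inductive_set A_set :: "'a::field_char_0 poly fract set" where
  const: "rat_const c \<in> A_set"
| t: "rat_t \<in> A_set"
| t_inverse: "inverse rat_t \<in> A_set"
| t1_inverse: "inverse (rat_t - 1) \<in> A_set"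
| add: "p \<in> A_set \<Longrightarrow> q \<in> A_set \<Longrightarrow> p + q \<in> A_set"
| mult: "p \<in> A_set \<Longrightarrow> q \<in> A_set \<Longrightarrow> p * q \<in> A_set"

lemma rat_const_hom:
  "rat_const 0 = 0" "rat_const 1 = 1"
  "rat_const (c + d) = rat_const c + rat_const d"
  "rat_const (c * d) = rat_const c * rat_const d"
  "rat_const (- c) = - rat_const c"
  by (simp_all add: rat_const_def flip: to_fract_add to_fract_mult to_fract_uminus one_pCons)

lemma A_set_0: "0 \<in> A_set" and A_set_1: "1 \<in> A_set"
  by (metis A_set.const rat_const_hom(1)) (metis A_set.const rat_const_hom(2))

lemma A_set_uminus: "p \<in> A_set \<Longrightarrow> - p \<in> A_set"
  by (metis A_set.const A_set.mult mult_minus1 rat_const_hom(2,5))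

lemma A_set_diff: "p \<in> A_set \<Longrightarrow> q \<in> A_set \<Longrightarrow> p - q \<in> A_set"
  by (metis A_set.add A_set_uminus add_uminus_conv_diff)

lemma A_set_power: "p \<in> A_set \<Longrightarrow> p ^ n \<in> A_set"
  by (induction n) (auto intro: A_set.mult A_set_1)

typedef (overloaded) 'a Alg = "A_set :: 'a::field_char_0 poly fract set"
  using A_set_0 by blast

setup_lifting type_definition_Alg

instantiation Alg :: (field_char_0) comm_ring_1
begin

lift_definition zero_Alg :: "'a Alg" is 0 by (rule A_set_0)
lift_definition one_Alg :: "'a Alg" is 1 by (rule A_set_1)
lift_definition plus_Alg :: "'a Alg \<Rightarrow> 'a Alg \<Rightarrow> 'a Alg" is "(+)" by (rule A_set.add)
lift_definition times_Alg :: "'a Alg \<Rightarrow> 'a Alg \<Rightarrow> 'a Alg" is "(*)" by (rule A_set.mult)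
lift_definition uminus_Alg :: "'a Alg \<Rightarrow> 'a Alg" is uminus by (rule A_set_uminus)
lift_definition minus_Alg :: "'a Alg \<Rightarrow> 'a Alg \<Rightarrow> 'a Alg" is "(-)" by (rule A_set_diff)

instance
  by standard (transfer; simp add: algebra_simps)+

end

lift_definition const_A :: "'a::field_char_0 \<Rightarrow> 'a Alg" is rat_const by (rule A_set.const)

lift_definition t_A :: "'a::field_char_0 Alg" is rat_t by (rule A_set.t)

lift_definition t'_A :: "'a::field_char_0 Alg" is "1 - inverse rat_t"
  by (intro A_set_diff A_set_1 A_set.t_inverse)

lift_definition t''_A :: "'a::field_char_0 Alg" is "inverse (1 - rat_t)"
  by (metis A_set.t1_inverse A_set_uminus inverse_minus_eq minus_diff_eq)

lift_definition minus_t_powi :: "int \<Rightarrow> 'a::field_char_0 Alg" is "\<lambda>k. (- rat_t) powi k"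
  by (simp add: power_int_def A_set_power A_set_uminus A_set.t A_set.t_inverse)

definition A_scale :: "'a::field_char_0 \<Rightarrow> 'a Alg \<Rightarrow> 'a Alg" where
  "A_scale c a = const_A c * a"

lemma const_A_hom:
  "const_A 0 = 0" "const_A 1 = 1"
  "const_A (c + d) = const_A c + const_A d" "const_A (c * d) = const_A c * const_A d"
  by (transfer; simp add: rat_const_hom)+


section \<open>The Lie algebra \<open>L(sl\<^sub>2)\<^sup>+ = sl\<^sub>2 \<otimes> \<A>\<close>\<close>

text \<open>Since \<open>e, f, h\<close> is a basis of \<open>sl\<^sub>2\<close>, every element of the tensor product is uniquely
  \<open>e \<otimes> a + f \<otimes> b + h \<otimes> c\<close>; it is represented by \<open>Sl2 a b c\<close>.  The lemmas
  \<open>tens_universal\<close> and \<open>loop_br_tens\<close> below justify this encoding.\<close>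

type_synonym 'a loop = "'a Alg sl2"

definition loop_scale :: "'a::field_char_0 \<Rightarrow> 'a loop \<Rightarrow> 'a loop" where
  "loop_scale c = map_sl2 (A_scale c)"

definition tens :: "'a::field_char_0 sl2 \<Rightarrow> 'a Alg \<Rightarrow> 'a loop" (infix \<open>\<otimes>\<close> 75) where
  "u \<otimes> a = map_sl2 (\<lambda>c. A_scale c a) u"

abbreviation loop_br :: "'a::field_char_0 loop \<Rightarrow> 'a loop \<Rightarrow> 'a loop" where
  "loop_br \<equiv> sl2_br"

definition loop_act :: "'a::field_char_0 loop \<Rightarrow> 'a Alg \<Rightarrow> 'a loop" (infixl \<open>\<lhd>\<close> 72) where
  "v \<lhd> b = map_sl2 (\<lambda>a. a * b) v"

lemmas loop_defs =
  loop_scale_def tens_def loop_act_def sl2_br_def sl2_scale_def sl2_ops A_scale_def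

global_interpretation loop: lie_algebra "loop_scale :: 'a::field_char_0 \<Rightarrow> _" loop_br
  by standard
    (auto simp: loop_defs const_A_hom algebra_simps sl2.map_sel intro: sl2.expand)

lemma loop_br_tens: "loop_br (u \<otimes> a) (v \<otimes> b) = sl2_br u v \<otimes> (a * b)"
proof -
  have two: "const_A 2 = 2" and diff: "const_A (c - d) = const_A c - const_A d" for c d :: 'a
    by (metis const_A_hom(2,3) one_add_one, metis const_A_hom(3) add_diff_cancel_right' diff_add_cancel)
  show ?thesis
    by (simp add: loop_defs sl2.map_sel const_A_hom two diff algebra_simps)
qed

lemma loop_act_tens: "(u \<otimes> a) \<lhd> b = u \<otimes> (a * b)"
  by (cases u) (simp add: loop_defs algebra_simps)

lemma tens_bilinear:
  "(u + v) \<otimes> a = u \<otimes> a + v \<otimes> a" "u \<otimes> (a + b) = u \<otimes> a + u \<otimes> b"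
  "sl2_scale c u \<otimes> a = loop_scale c (u \<otimes> a)" "u \<otimes> A_scale c a = loop_scale c (u \<otimes> a)"
  by (auto simp: loop_defs const_A_hom algebra_simps sl2.map_sel intro: sl2.expand)

lemma tens_decomp: "v = sl2_e \<otimes> e_coeff v + sl2_f \<otimes> f_coeff v + sl2_h \<otimes> h_coeff v"
  by (cases v) (simp add: loop_defs sl2_e_def sl2_f_def sl2_h_def const_A_hom)

lemma tens_universal:
  fixes \<beta> :: "'a::field_char_0 sl2 \<Rightarrow> 'a Alg \<Rightarrow> 'v::ab_group_add"
  assumes "vector_space s"
    and left: "\<And>a. Vector_Spaces.linear sl2_scale s (\<lambda>u. \<beta> u a)"
    and right: "\<And>u. Vector_Spaces.linear A_scale s (\<beta> u)"
  shows "\<exists>!g. Vector_Spaces.linear loop_scale s g \<and> (\<forall>u a. g (u \<otimes> a) = \<beta> u a)"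
proof -
  interpret vector_space s by fact
  define g where
    "g v = \<beta> sl2_e (e_coeff v) + \<beta> sl2_f (f_coeff v) + \<beta> sl2_h (h_coeff v)" for v
  have L: "\<beta> (u + v) a = \<beta> u a + \<beta> v a" "\<beta> (sl2_scale c u) a = s c (\<beta> u a)" for u v a c
    using module_hom.add[OF Vector_Spaces.linear.axioms(3)[OF left]]
      module_hom.scale[OF Vector_Spaces.linear.axioms(3)[OF left]] by blast+
  have R: "\<beta> u (a + b) = \<beta> u a + \<beta> u b" "\<beta> u (A_scale c a) = s c (\<beta> u a)" for u a b c
    using module_hom.add[OF Vector_Spaces.linear.axioms(3)[OF right]]
      module_hom.scale[OF Vector_Spaces.linear.axioms(3)[OF right]] by blast+
  have "Vector_Spaces.linear loop_scale s g"
  proof (intro Vector_Spaces.linear.intro module_hom.intro module_hom_axioms.intro)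
    show "g (u + v) = g u + g v" for u v
      by (simp add: g_def sl2_ops R algebra_simps)
    show "g (loop_scale c u) = s c (g u)" for c u
      by (simp add: g_def loop_scale_def sl2.map_sel R scale_right_distrib)
  qed unfold_locales
  moreover have "g (u \<otimes> a) = \<beta> u a" for u a
  proof (cases u)
    case (Sl2 p q r)
    have "g (u \<otimes> a) = s p (\<beta> sl2_e a) + s q (\<beta> sl2_f a) + s r (\<beta> sl2_h a)"
      by (simp add: Sl2 g_def tens_def R)
    also have "\<dots> = \<beta> u a"
      by (simp add: Sl2 sl2_decomp L)
    finally show ?thesis .
  qed
  moreover have "g1 = g"
    if g1: "Vector_Spaces.linear loop_scale s g1 \<and> (\<forall>u a. g1 (u \<otimes> a) = \<beta> u a)" for g1
  proof
    fix v
    have "g1 (p + q) = g1 p + g1 q" for p q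
      using g1 module_hom.add[OF Vector_Spaces.linear.axioms(3)] by blast
    then show "g1 v = g v"
      using g1 by (subst tens_decomp) (simp add: g_def)
  qed
  ultimately show ?thesis by blast
qed


section \<open>The Onsager subalgebra and its three families\<close>

definition onsager_A :: "'a::field_char_0 loop" where
  "onsager_A = sl2_x \<otimes> 1"

definition onsager_B :: "'a::field_char_0 loop" where
  "onsager_B = sl2_y \<otimes> t_A + sl2_z \<otimes> (t_A - 1)"

definition Onsager :: "'a::field_char_0 loop set" where
  "Onsager = lie_subalgebra_generated loop_scale loop_br {onsager_A, onsager_B}"

definition A_ud :: "nat \<Rightarrow> 'a::field_char_0 loop" where
  "A_ud i = sl2_x \<otimes> (- t_A) ^ i"

definition B_ud :: "nat \<Rightarrow> 'a::field_char_0 loop" where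
  "B_ud i = (- (sl2_y \<otimes> t_A) - sl2_z \<otimes> (t_A - 1)) \<lhd> (- t_A) ^ i"

text \<open>For \<open>i = 0\<close> the exponent \<open>i - 1\<close> is \<open>-1\<close>, hence the integer power.\<close>

definition \<psi>_ud :: "nat \<Rightarrow> 'a::field_char_0 loop" where
  "\<psi>_ud i = (sl2_x \<otimes> 1 - sl2_z \<otimes> (t_A - 1)) \<lhd> minus_t_powi (int i - 1)"

end

theory Submission
  imports Defs
begin

text \<open>In the basis \<open>e, f, h\<close> the three families are \<open>w (-t)\<^sup>i\<close> for \<open>w = A = 2e - h\<close>,
  \<open>w = -B = 2tf + h\<close> and \<open>w = \<psi>\<^sub>1 = 2e - th\<close>.  Each such \<open>w\<close> has a coefficient that is a
  nonzero scalar, so its centralizer in \<open>L(sl\<^sub>2)\<^sup>+\<close> is the free rank one module \<open>w\<A>\<close>.  The cubic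
  condition defining \<open>X\<^sub>i\<^sub>j\<close> is automatic, because \<open>(ad u)\<^sup>3 = 4 ad u\<close> for every
  \<open>u = ae + bf + ch\<close> with \<open>c\<^sup>2 + ab = 1\<close>.  Since \<open>O\<close> lies in \<open>sl\<^sub>2 \<otimes> \<bbbF>[t]\<close>, the coefficient of an
  element of \<open>w\<A> \<inter> O\<close> is a polynomial.  Conversely \<open>[A,B] = 4\<psi>\<^sub>1 - 2A + 2B\<close>,
  \<open>[A,\<psi>\<^sub>1] = 2tA - 2\<psi>\<^sub>1\<close> and \<open>[B,\<psi>\<^sub>1] = -2tB - 2\<psi>\<^sub>1\<close> yield inductively all
  \<open>A t\<^sup>i\<close>, \<open>B t\<^sup>i\<close>, \<open>\<psi>\<^sub>1 t\<^sup>i\<close> in \<open>O\<close>.\<close>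

section \<open>Independence and bases of indexed families\<close>

lemma (in vector_space) independent_range_iff:
  fixes b :: "'i \<Rightarrow> 'b"
  assumes "inj b"
  shows "independent (range b) \<longleftrightarrow>
    (\<forall>T c. finite T \<longrightarrow> (\<Sum>i\<in>T. scale (c i) (b i)) = 0 \<longrightarrow> (\<forall>i\<in>T. c i = 0))"
    (is "_ \<longleftrightarrow> ?R")
proof
  assume ind: "independent (range b)"
  show ?R
  proof (intro allI impI ballI)
    fix T c i assume T: "finite T" "(\<Sum>i\<in>T. scale (c i) (b i)) = 0" "i \<in> T"
    have "(\<Sum>v\<in>b ` T. scale (c (inv b v)) v) = 0"
      using T assms by (subst sum.reindex) (auto simp: inj_on_def)
    then have "c (inv b (b i)) = 0"
      using ind T by (intro independentD[of "range b" "b ` T" "\<lambda>v. c (inv b v)"]) auto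
    then show "c i = 0" using assms by simp
  qed
next
  assume R: ?R
  show "independent (range b)"
  proof
    assume "dependent (range b)"
    then obtain S u where S: "finite S" "S \<subseteq> range b" "(\<Sum>v\<in>S. scale (u v) v) = 0"
      "\<exists>v\<in>S. u v \<noteq> 0"
      unfolding dependent_explicit by blast
    obtain T where T: "S = b ` T" using S(2) by (auto simp: subset_image_iff)
    have inj: "inj_on b T" using assms by (auto simp: inj_on_def)
    have "finite T" using S(1) T inj by (simp add: finite_image_iff)
    moreover have "(\<Sum>i\<in>T. scale (u (b i)) (b i)) = 0"
      using S(3) T inj by (simp add: sum.reindex)
    ultimately have "\<forall>i\<in>T. u (b i) = 0" using R[rule_format, of T "\<lambda>i. u (b i)"] by blast
    then show False using S(4) T by auto
  qed
qed

text \<open>Applied to \<open>\<lambda>a. w \<lhd> a\<close>, so that independence needs checking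
  only once, for the powers of -t.\<close>

lemma family_basis_linear_image:
  assumes lin: "Vector_Spaces.linear s1 s2 g" and inj: "inj g" and b: "family_basis s1 b W"
  shows "family_basis s2 (\<lambda>i. g (b i)) (g ` W)"
proof -
  interpret Vector_Spaces.linear s1 s2 g by (rule lin)
  have "range (\<lambda>i. g (b i)) = g ` range b" by auto
  then show ?thesis
    using b inj unfolding family_basis_def
    by (auto simp: inj_def span_image inj_on_def dest!: independent_injective_image)
qed

section \<open>The polynomial subring F[t] of the coefficient algebra\<close>

global_interpretation Alg: vector_space "A_scale :: 'a::field_char_0 \<Rightarrow> _"
  by standard (simp_all add: A_scale_def const_A_hom algebra_simps)

lemma const_A_numeral: "const_A (numeral n) = numeral n"
proof -
  have "const_A (of_nat k) = of_nat k" for k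
    by (induction k) (simp_all add: const_A_hom)
  from this[of "numeral n"] show ?thesis by simp
qed

text \<open>\<open>Alg\<close> is only a commutative ring, so halving is done by multiplying with
  the constant 1/2.\<close>

lemma two_const_half: "2 * (const_A (1/2) * a) = a"
proof -
  have "2 * const_A (1/2) = const_A (2 * (1/2) :: 'a)"
    by (simp only: const_A_hom const_A_numeral)
  then show ?thesis by (simp add: const_A_hom mult.assoc[symmetric])
qed

lemma Alg_two_cancel: "2 * a = 2 * b \<longleftrightarrow> a = (b :: 'a::field_char_0 Alg)"
  by (metis two_const_half mult.left_commute)

text \<open>This is F[t]; spanning it by powers of -t instead of t matches the factors in the three
  families.\<close>

definition Alg_poly :: "'a::field_char_0 Alg set" where
  "Alg_poly = Alg.span (range (\<lambda>i. (- t_A) ^ i))"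

lemma subspace_Alg_poly: "Alg.subspace Alg_poly"
  by (simp add: Alg_poly_def)

lemma Alg_poly_power: "(- t_A) ^ i \<in> Alg_poly"
  by (simp add: Alg_poly_def Alg.span_base)

lemma Alg_poly_scale: "a \<in> Alg_poly \<Longrightarrow> const_A c * a \<in> Alg_poly"
  using Alg.subspace_scale[OF subspace_Alg_poly] by (simp add: A_scale_def)

lemma Alg_poly_add: "a \<in> Alg_poly \<Longrightarrow> b \<in> Alg_poly \<Longrightarrow> a + b \<in> Alg_poly"
  and Alg_poly_diff: "a \<in> Alg_poly \<Longrightarrow> b \<in> Alg_poly \<Longrightarrow> a - b \<in> Alg_poly"
  and Alg_poly_uminus: "a \<in> Alg_poly \<Longrightarrow> - a \<in> Alg_poly"
  using subspace_Alg_poly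
  by (blast intro: Alg.subspace_add Alg.subspace_diff Alg.subspace_neg)+

lemma Alg_poly_0: "0 \<in> Alg_poly"
  by (rule Alg.subspace_0[OF subspace_Alg_poly])

lemma Alg_poly_1: "1 \<in> Alg_poly"
  using Alg_poly_power[of 0] by simp

lemma Alg_poly_t: "t_A \<in> Alg_poly"
  using Alg_poly_uminus[OF Alg_poly_power[of 1]] by simp

lemma Alg_poly_mult:
  assumes "a \<in> Alg_poly" "b \<in> Alg_poly"
  shows "a * b \<in> Alg_poly"
proof -
  have pow: "b * (- t_A) ^ i \<in> Alg_poly" for i
    using assms(2)[unfolded Alg_poly_def]
  proof (induction rule: Alg.span_induct_alt)
    case (step c x y)
    then obtain j where "x = (- t_A) ^ j" by blast
    then show ?case
      using step Alg_poly_add[OF Alg_poly_scale[OF Alg_poly_power[of "j + i"], of c]]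
      by (simp add: A_scale_def power_add algebra_simps)
  qed (simp add: Alg_poly_0)
  show ?thesis
    using assms(1)[unfolded Alg_poly_def]
  proof (induction rule: Alg.span_induct_alt)
    case (step c x y)
    then obtain j where "x = (- t_A) ^ j" by blast
    then show ?case
      using step Alg_poly_add[OF Alg_poly_scale[OF pow[of j], of c]]
      by (simp add: A_scale_def algebra_simps)
  qed (simp add: Alg_poly_0)
qed

lemma Alg_poly_numeral: "numeral n \<in> Alg_poly"
  using Alg_poly_scale[OF Alg_poly_1, of "numeral n"] by (simp add: const_A_numeral)

lemma Rep_Alg_sum: "Rep_Alg (sum f S) = (\<Sum>i\<in>S. Rep_Alg (f i))"
  by (induction S rule: infinite_finite_induct) (simp_all add: zero_Alg.rep_eq plus_Alg.rep_eq)

lemma Rep_Alg_power: "Rep_Alg (a ^ i) = Rep_Alg a ^ i"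
  by (induction i) (simp_all add: one_Alg.rep_eq times_Alg.rep_eq)

text \<open>A linear relation among powers of -t is the image of a polynomial \<open>p\<close> in
  the fraction field. Since \<open>to_fract\<close> is injective, \<open>p\<close> = 0, and its
  coefficient at \<open>j\<close> is \<open>c j\<close> up to sign.\<close>

lemma minus_t_sum_eq_0:
  assumes "finite T" "(\<Sum>i\<in>T. A_scale (c i) ((- t_A) ^ i)) = 0" "j \<in> T"
  shows "c j = 0"
proof -
  define p where "p = (\<Sum>i\<in>T. smult (c i) ([:0, -1:] ^ i))"
  have pow: "to_fract (q ^ i) = to_fract q ^ i" for q :: "'a poly" and i
    by (induction i) (simp_all add: to_fract_mult)
  have "to_fract (sum f S) = (\<Sum>i\<in>S. to_fract (f i))" for f :: "nat \<Rightarrow> 'a poly" and S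
    by (induction S rule: infinite_finite_induct) (simp_all add: to_fract_add)
  then have "to_fract p = (\<Sum>i\<in>T. to_fract [:c i:] * to_fract [:0, -1:] ^ i)"
    by (simp add: p_def pow flip: to_fract_mult pow)
  also have "to_fract [:0, -1:] = - (rat_t :: 'a poly fract)"
    by (simp add: rat_t_def flip: to_fract_uminus)
  also have "(\<Sum>i\<in>T. to_fract [:c i:] * (- rat_t) ^ i) = Rep_Alg (\<Sum>i\<in>T. A_scale (c i) ((- t_A) ^ i))"
    by (simp add: Rep_Alg_sum A_scale_def times_Alg.rep_eq Rep_Alg_power uminus_Alg.rep_eq
        t_A.rep_eq const_A.rep_eq rat_const_def)
  also have "\<dots> = to_fract 0"
    using assms(2) by (simp add: zero_Alg.rep_eq)
  finally have "p = 0" by (simp only: to_fract_eq_iff)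
  have "[:0, -1:] = monom (-1 :: 'a) 1" by (simp add: monom_altdef)
  then have "[:0, -1:] ^ i = monom ((-1 :: 'a) ^ i) i" for i
    by (simp only: monom_power mult_1)
  then have "coeff p j = (\<Sum>i\<in>T. if i = j then c i * (-1) ^ i else 0)"
    by (auto simp: p_def coeff_sum intro!: sum.cong)
  with assms \<open>p = 0\<close> show ?thesis by simp
qed

lemma inj_minus_t_power: "inj (\<lambda>i. (- t_A :: 'a::field_char_0 Alg) ^ i)"
proof (rule injI, rule ccontr)
  fix i j assume *: "(- t_A :: 'a Alg) ^ i = (- t_A) ^ j" "i \<noteq> j"
  have "(\<Sum>k\<in>{i, j}. A_scale (if k = i then 1 else - 1) ((- t_A :: 'a Alg) ^ k)) = 0"
    using * Alg.scale_minus_left[of 1 "(- t_A :: 'a Alg) ^ j"] by simp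
  from minus_t_sum_eq_0[OF _ this, of i] show False by simp
qed

lemma family_basis_Alg_poly: "family_basis A_scale (\<lambda>i. (- t_A) ^ i) Alg_poly"
  unfolding family_basis_def Alg_poly_def Alg.independent_range_iff[OF inj_minus_t_power]
  using minus_t_sum_eq_0 inj_minus_t_power by blast

section \<open>Coordinates in the loop algebra\<close>

lemma sl2_eq_iff: "u = v \<longleftrightarrow> e_coeff u = e_coeff v \<and> f_coeff u = f_coeff v \<and> h_coeff u = h_coeff v"
  by (cases u, cases v) simp

lemma coeff_simps [simp]:
  "e_coeff 0 = 0" "f_coeff 0 = 0" "h_coeff 0 = 0"
  "e_coeff (u + v) = e_coeff u + e_coeff v"
  "f_coeff (u + v) = f_coeff u + f_coeff v"
  "h_coeff (u + v) = h_coeff u + h_coeff v"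
  "e_coeff (u - v) = e_coeff u - e_coeff v"
  "f_coeff (u - v) = f_coeff u - f_coeff v"
  "h_coeff (u - v) = h_coeff u - h_coeff v"
  "e_coeff (- u) = - e_coeff u" "f_coeff (- u) = - f_coeff u" "h_coeff (- u) = - h_coeff u"
  by (simp_all add: sl2_ops)

lemma coeff_loop_simps [simp]:
  "e_coeff (w \<lhd> a) = e_coeff w * a" "f_coeff (w \<lhd> a) = f_coeff w * a"
  "h_coeff (w \<lhd> a) = h_coeff w * a"
  "e_coeff (loop_scale c w) = const_A c * e_coeff w"
  "f_coeff (loop_scale c w) = const_A c * f_coeff w"
  "h_coeff (loop_scale c w) = const_A c * h_coeff w"
  by (simp_all add: loop_act_def loop_scale_def sl2.map_sel A_scale_def)

lemma coeff_br [simp]: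
  "e_coeff (sl2_br u v) = 2 * (h_coeff u * e_coeff v - e_coeff u * h_coeff v)"
  "f_coeff (sl2_br u v) = 2 * (f_coeff u * h_coeff v - h_coeff u * f_coeff v)"
  "h_coeff (sl2_br u v) = e_coeff u * f_coeff v - f_coeff u * e_coeff v"
  by (simp_all add: sl2_br_def)

lemma sl2_xyz_tens:
  "sl2_x \<otimes> a = Sl2 (2 * a) 0 (- a)" "sl2_y \<otimes> a = Sl2 0 (- 2 * a) (- a)" "sl2_z \<otimes> a = Sl2 0 0 a"
proof -
  have "const_A (- c) = - const_A c" for c :: 'a
    using const_A_hom(3)[of c "- c"] by (simp add: const_A_hom eq_neg_iff_add_eq_0 add.commute)
  then show "sl2_x \<otimes> a = Sl2 (2 * a) 0 (- a)" "sl2_y \<otimes> a = Sl2 0 (- 2 * a) (- a)"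
      "sl2_z \<otimes> a = Sl2 0 0 a"
    by (simp_all add: sl2_x_def sl2_y_def sl2_z_def sl2_e_def sl2_f_def sl2_h_def
        tens_def sl2_scale_def sl2_ops A_scale_def const_A_hom const_A_numeral)
qed

lemma linear_loop_act: "Vector_Spaces.linear A_scale loop_scale (\<lambda>a. w \<lhd> a)"
  by unfold_locales (simp_all add: sl2_eq_iff A_scale_def algebra_simps)

lemma sl2_br_act_left: "loop_br (u \<lhd> a) v = loop_br u v \<lhd> a"
  and sl2_br_act_right: "loop_br u (v \<lhd> a) = loop_br u v \<lhd> a"
  by (simp_all add: sl2_eq_iff algebra_simps)

lemma sl2_br_uminus_left: "sl2_br (- u) v = - sl2_br u v"
  by (simp add: sl2_eq_iff algebra_simps)

text \<open>Read as a 2x2 matrix, \<open>u\<close> has trace 0 and determinant -1, hence eigenvalues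
  1 and -1, which suggests the eigenvalues 0, 2, -2 for ad \<open>u\<close>.\<close>

lemma ad_cubed:
  assumes "h_coeff u * h_coeff u + e_coeff u * f_coeff u = 1"
  shows "sl2_br u (sl2_br u (sl2_br u v)) = loop_scale 4 (sl2_br u v)"
proof -
  obtain a b c where u: "u = Sl2 a b c" by (cases u)
  obtain p q r where v: "v = Sl2 p q r" by (cases v)
  have n: "c * c + a * b = 1" using assms u by simp
  \<comment> \<open>Inserting the factor \<open>c * c + a * b\<close> = 1 makes both sides cubic in
    \<open>a\<close>, \<open>b\<close>, \<open>c\<close>; what remains is a polynomial
    identity.\<close>
  have "4 * (2 * (c * p - a * r)) = 4 * (c * c + a * b) * (2 * (c * p - a * r))"
    "4 * (2 * (b * r - c * q)) = 4 * (c * c + a * b) * (2 * (b * r - c * q))"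
    "4 * (a * q - b * p) = 4 * (c * c + a * b) * (a * q - b * p)"
    using n by simp_all
  then show ?thesis
    by (simp add: sl2_eq_iff u v const_A_numeral) (simp add: algebra_simps)
qed


section \<open>The Onsager subalgebra\<close>

text \<open>This is \<open>\<psi>_ud 1\<close>, the first member of the shifted third
  family.\<close>

definition onsager_psi :: "'a::field_char_0 loop" where
  "onsager_psi = sl2_x \<otimes> 1 - sl2_z \<otimes> (t_A - 1)"

lemma onsager_coords:
  "onsager_A = Sl2 2 0 (- 1)" "onsager_B = Sl2 0 (- 2 * t_A) (- 1)" "onsager_psi = Sl2 2 0 (- t_A)"
  by (simp_all add: onsager_A_def onsager_B_def onsager_psi_def sl2_xyz_tens sl2_eq_iff)

lemma lie_subalgebra_Onsager: "lie_subalgebra loop_scale loop_br Onsager"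
  unfolding Onsager_def lie_subalgebra_generated_def lie_subalgebra_def loop.subspace_def
  by blast

lemma Onsager_generators: "onsager_A \<in> Onsager" "onsager_B \<in> Onsager"
  by (auto simp: Onsager_def lie_subalgebra_generated_def)

lemma Onsager_br: "u \<in> Onsager \<Longrightarrow> v \<in> Onsager \<Longrightarrow> loop_br u v \<in> Onsager"
  and subspace_Onsager: "loop.subspace Onsager"
  using lie_subalgebra_Onsager by (auto simp: lie_subalgebra_def)

text \<open>The elements with polynomial coefficients form a Lie subalgebra that contains both
  generators.\<close>

lemma Onsager_coeff_Alg_poly:
  assumes "v \<in> Onsager"
  shows "e_coeff v \<in> Alg_poly" "f_coeff v \<in> Alg_poly" "h_coeff v \<in> Alg_poly"
proof -
  define S :: "'a loop set" where
    "S = {v. e_coeff v \<in> Alg_poly \<and> f_coeff v \<in> Alg_poly \<and> h_coeff v \<in> Alg_poly}"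
  have "lie_subalgebra loop_scale loop_br S"
    unfolding lie_subalgebra_def loop.subspace_def S_def
    by (auto intro!: Alg_poly_0 Alg_poly_add Alg_poly_diff Alg_poly_mult Alg_poly_scale Alg_poly_numeral)
  moreover have "{onsager_A, onsager_B} \<subseteq> S"
    by (auto simp: S_def onsager_coords Alg_poly_0 Alg_poly_1 Alg_poly_t
        intro!: Alg_poly_uminus Alg_poly_mult Alg_poly_numeral)
  ultimately have "Onsager \<subseteq> S"
    by (auto simp: Onsager_def lie_subalgebra_generated_def)
  then show "e_coeff v \<in> Alg_poly" "f_coeff v \<in> Alg_poly" "h_coeff v \<in> Alg_poly"
    using assms by (auto simp: S_def)
qed

lemma onsager_brackets:
  "loop_br onsager_A onsager_B =
     loop_scale 4 onsager_psi - loop_scale 2 onsager_A + loop_scale 2 onsager_B"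
  "loop_br onsager_A onsager_psi =
     - loop_scale 2 (onsager_A \<lhd> (- t_A)) - loop_scale 2 onsager_psi"
  "loop_br onsager_B onsager_psi =
     loop_scale 2 (onsager_B \<lhd> (- t_A)) - loop_scale 2 onsager_psi"
  by (simp_all add: sl2_eq_iff onsager_coords const_A_numeral algebra_simps)

lemma Onsager_cancel_scale: "c \<noteq> 0 \<Longrightarrow> loop_scale c v \<in> Onsager \<Longrightarrow> v \<in> Onsager"
  using loop.subspace_scale[OF subspace_Onsager, of "loop_scale c v" "inverse c"] by simp

lemma loop_act_add_left: "(u + v) \<lhd> a = u \<lhd> a + v \<lhd> a"
  and loop_act_diff_left: "(u - v) \<lhd> a = u \<lhd> a - v \<lhd> a"
  and loop_act_uminus_left: "(- v) \<lhd> a = - (v \<lhd> a)"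
  and loop_act_scale: "loop_scale c v \<lhd> a = loop_scale c (v \<lhd> a)"
  and loop_act_act: "v \<lhd> a \<lhd> b = v \<lhd> (a * b)"
  and loop_act_1: "v \<lhd> 1 = v"
  by (simp_all add: sl2_eq_iff algebra_simps)

text \<open>The bracket is linear over the coefficient algebra, so each relation in
  \<open>onsager_brackets\<close> may be multiplied by any \<open>a\<close>. Solved for its new
  term, it gives psi from A and B, and then -tA and -tB from psi, which advances the exponent by
  one.\<close>

lemma Onsager_families:
  "{onsager_A \<lhd> (- t_A) ^ i, onsager_B \<lhd> (- t_A) ^ i, onsager_psi \<lhd> (- t_A) ^ i}
    \<subseteq> (Onsager :: 'a::field_char_0 loop set)"
proof -
  note closed = loop.subspace_add[OF subspace_Onsager] loop.subspace_diff[OF subspace_Onsager]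
    loop.subspace_scale[OF subspace_Onsager] loop.subspace_neg[OF subspace_Onsager]
  have psi: "onsager_psi \<lhd> a \<in> Onsager"
    if "onsager_A \<lhd> a \<in> Onsager" "onsager_B \<lhd> a \<in> Onsager" for a :: "'a Alg"
  proof (rule Onsager_cancel_scale)
    have "loop_scale 4 (onsager_psi \<lhd> a) = loop_br onsager_A (onsager_B \<lhd> a)
        + loop_scale 2 (onsager_A \<lhd> a) - loop_scale 2 (onsager_B \<lhd> a)"
      unfolding sl2_br_act_right onsager_brackets
      by (simp add: loop_act_add_left loop_act_diff_left loop_act_scale)
    then show "loop_scale 4 (onsager_psi \<lhd> a) \<in> Onsager"
      using that by (auto intro!: closed Onsager_br Onsager_generators)
  qed simp
  have A: "onsager_A \<lhd> (- t_A * a) \<in> Onsager" if "onsager_psi \<lhd> a \<in> Onsager" for a :: "'a Alg"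
  proof (rule Onsager_cancel_scale)
    have "loop_scale 2 (onsager_A \<lhd> (- t_A * a)) =
        - loop_br onsager_A (onsager_psi \<lhd> a) - loop_scale 2 (onsager_psi \<lhd> a)"
      unfolding sl2_br_act_right onsager_brackets
      by (simp only: loop_act_diff_left loop_act_uminus_left loop_act_scale loop_act_act) simp
    then show "loop_scale 2 (onsager_A \<lhd> (- t_A * a)) \<in> Onsager"
      using that by (auto intro!: closed Onsager_br Onsager_generators)
  qed simp
  have B: "onsager_B \<lhd> (- t_A * a) \<in> Onsager" if "onsager_psi \<lhd> a \<in> Onsager" for a :: "'a Alg"
  proof (rule Onsager_cancel_scale)
    have "loop_scale 2 (onsager_B \<lhd> (- t_A * a)) =
        loop_br onsager_B (onsager_psi \<lhd> a) + loop_scale 2 (onsager_psi \<lhd> a)"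
      unfolding sl2_br_act_right onsager_brackets
      by (simp only: loop_act_diff_left loop_act_scale loop_act_act) simp
    then show "loop_scale 2 (onsager_B \<lhd> (- t_A * a)) \<in> Onsager"
      using that by (auto intro!: closed Onsager_br Onsager_generators)
  qed simp
  show ?thesis
  proof (induction i)
    case 0
    show ?case using psi[of 1] by (simp add: loop_act_1 Onsager_generators)
  next
    case (Suc i)
    then show ?case using A B psi unfolding power_Suc by auto
  qed
qed


section \<open>Centralizers\<close>

text \<open>As the h-coefficient of \<open>w\<close> is a unit, the e- and f-components of [w,v] = 0
  determine \<open>v\<close> from its h-coefficient.\<close>

lemma h_coeff_centralizer:
  assumes "h_coeff w = - 1" "loop_br w v = 0"
  shows "v = w \<lhd> (- h_coeff v)"
proof -
  have "2 * (- e_coeff v - e_coeff w * h_coeff v) = 2 * 0"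
    "2 * (f_coeff w * h_coeff v + f_coeff v) = 2 * 0"
    using assms by (simp_all add: sl2_eq_iff)
  then have "- e_coeff v - e_coeff w * h_coeff v = 0" "f_coeff w * h_coeff v + f_coeff v = 0"
    unfolding Alg_two_cancel by simp_all
  then have "e_coeff v = - (e_coeff w * h_coeff v)" "f_coeff v = - (f_coeff w * h_coeff v)"
    by (metis eq_iff_diff_eq_0 minus_minus, metis add_eq_0_iff)
  then show ?thesis
    using assms(1) by (simp add: sl2_eq_iff)
qed

text \<open>Meant for psi: its h-coefficient -t is a unit too, but dividing by it could leave F[t].
  Solving through the e-coefficient 2 keeps the multiplier polynomial for \<open>v\<close> in
  O.\<close>

lemma e_coeff_centralizer:
  assumes "e_coeff w = 2" "loop_br w v = 0"
  shows "v = w \<lhd> (const_A (1/2) * e_coeff v)"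
proof -
  have "2 * (h_coeff w * e_coeff v - 2 * h_coeff v) = 2 * 0"
    "2 * f_coeff v = f_coeff w * e_coeff v"
    using assms by (simp_all add: sl2_eq_iff)
  then have "2 * h_coeff v = h_coeff w * e_coeff v" "2 * f_coeff v = f_coeff w * e_coeff v"
    unfolding Alg_two_cancel by simp_all
  then have "2 * h_coeff v = 2 * (h_coeff w * (const_A (1/2) * e_coeff v))"
    "2 * f_coeff v = 2 * (f_coeff w * (const_A (1/2) * e_coeff v))"
    by (metis two_const_half mult.left_commute)+
  then show ?thesis
    using assms(1) unfolding Alg_two_cancel by (simp add: sl2_eq_iff two_const_half)
qed

text \<open>The function \<open>g\<close> recovers the multiplier \<open>a\<close> from
  \<open>w \<lhd> a\<close>. The centralizer then consists of all multiples of \<open>w\<close>;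
  \<open>poly\<close> and \<open>mem\<close> show that those in O are exactly the ones with
  polynomial multiplier, and the powers of -t are a basis of F[t].\<close>

lemma family_basis_centralizer:
  assumes centralizer: "\<And>v. loop_br w v = 0 \<Longrightarrow> v = w \<lhd> g v"
    and left_inv: "\<And>a. g (w \<lhd> a) = a"
    and poly: "\<And>v. v \<in> Onsager \<Longrightarrow> g v \<in> Alg_poly"
    and mem: "\<And>i. w \<lhd> (- t_A) ^ i \<in> Onsager"
  shows "family_basis loop_scale (\<lambda>i. w \<lhd> (- t_A) ^ i) ({v. loop_br w v = 0} \<inter> Onsager)"
proof -
  have inj: "inj (\<lambda>a. w \<lhd> a)" by (metis injI left_inv)
  have basis: "family_basis loop_scale (\<lambda>i. w \<lhd> (- t_A) ^ i) ((\<lambda>a. w \<lhd> a) ` Alg_poly)"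
    by (rule family_basis_linear_image[OF linear_loop_act inj family_basis_Alg_poly])
  have "loop_br w (w \<lhd> a) = 0" for a
    by (simp add: sl2_br_act_right sl2.br_self) (simp add: sl2_eq_iff)
  moreover have "(\<lambda>a. w \<lhd> a) ` Alg_poly \<subseteq> Onsager"
    using basis mem loop.span_minimal[OF _ subspace_Onsager]
    by (metis (no_types, lifting) family_basis_def image_subset_iff)
  ultimately have "(\<lambda>a. w \<lhd> a) ` Alg_poly = {v. loop_br w v = 0} \<inter> Onsager"
    using centralizer poly by blast
  with basis show ?thesis by simp
qed

section \<open>The images of the spaces of \<open>x_ij\<close>-like elements\<close>

lemma tet_x_swap: "i \<noteq> j \<Longrightarrow> tet_x j i = - tet_x i j"
proof -
  assume "i \<noteq> j"
  then have "tet_x i j + tet_x j i = (0 :: 'a tet)"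
    by transfer (intro lie_cong.rel tet_rel.intros)
  then show "tet_x j i = - (tet_x i j :: 'a tet)" by (metis minus_unique)
qed

text \<open>By \<open>ad_cubed\<close> the condition \<open>norm\<close> makes the cubic relation
  hold for every element, so only the centralizer condition is left.\<close>

lemma image_tet_X:
  fixes \<sigma> :: "'a::field_char_0 tet \<Rightarrow> 'a loop"
  assumes iso: "lie_iso tet_scale tet_br loop_scale loop_br \<sigma>"
    and dist: "distinct [i, j, k, h]"
    and norm: "h_coeff (\<sigma> (tet_x k h)) * h_coeff (\<sigma> (tet_x k h))
      + e_coeff (\<sigma> (tet_x k h)) * f_coeff (\<sigma> (tet_x k h)) = 1"
  shows "\<sigma> ` tet_X i j = {v. loop_br (\<sigma> (tet_x i j)) v = 0}"
proof -
  have lin: "Vector_Spaces.linear tet_scale loop_scale \<sigma>"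
    and br: "\<sigma> (tet_br u v) = loop_br (\<sigma> u) (\<sigma> v)" and "bij \<sigma>" for u v
    using iso by (auto simp: lie_iso_def)
  interpret \<sigma>: Vector_Spaces.linear tet_scale loop_scale \<sigma> by (rule lin)
  have inj: "\<sigma> u = \<sigma> v \<longleftrightarrow> u = v" for u v
    using \<open>bij \<sigma>\<close> by (metis bij_pointE)
  have cube: "tet_br (tet_x k' h') (tet_br (tet_x k' h') (tet_br (tet_x k' h') \<xi>))
      = tet_scale 4 (tet_br (tet_x k' h') \<xi>)" if "{h', i, j, k'} = UNIV" for h' k' and \<xi> :: "'a tet"
  proof -
    \<comment> \<open>The complementary pair is fixed up to order; swapping it changes the sign of
      the generator, which does not affect the quadratic expression in \<open>norm\<close>.\<close>
    have "k \<in> {h', i, j, k'}" "h \<in> {h', i, j, k'}" using that by simp_all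
    with dist consider "k' = k" "h' = h" | "k' = h" "h' = k" by auto
    then have "\<sigma> (tet_x k' h') = \<sigma> (tet_x k h) \<or> \<sigma> (tet_x k' h') = - \<sigma> (tet_x k h)"
      using dist tet_x_swap[of k h, where ?'a = 'a] by cases (auto simp: \<sigma>.neg)
    then have "h_coeff (\<sigma> (tet_x k' h')) * h_coeff (\<sigma> (tet_x k' h'))
      + e_coeff (\<sigma> (tet_x k' h')) * f_coeff (\<sigma> (tet_x k' h')) = 1"
      using norm by auto
    from ad_cubed[OF this, of "\<sigma> \<xi>"] show ?thesis
      by (simp flip: inj add: br \<sigma>.scale)
  qed
  have "tet_X i j = {\<xi>. loop_br (\<sigma> (tet_x i j)) (\<sigma> \<xi>) = 0}"
    using cube by (auto simp: tet_X_def simp flip: br) (simp_all add: \<sigma>.zero flip: inj)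
  then show ?thesis
    using \<open>bij \<sigma>\<close> by (auto simp: bij_def surj_def)
qed

text \<open>Here t' - 1 is the negative of the inverse of t, hence a unit of the coefficient
  algebra.\<close>

lemma t'_A_mult_t: "(t'_A - 1) * t_A = - 1"
  by transfer (simp add: rat_t_def)

lemma minus_t_powi_of_nat: "minus_t_powi (int n) = (- t_A) ^ n"
  by (simp add: minus_t_powi.rep_eq Rep_Alg_power uminus_Alg.rep_eq t_A.rep_eq flip: Rep_Alg_inject)

theorem lemma9p2:
  fixes \<sigma> :: "'a::field_char_0 tet \<Rightarrow> 'a loop"
  assumes "lie_iso tet_scale tet_br loop_scale loop_br \<sigma>"
    and "\<sigma> (tet_x 1 2) = sl2_x \<otimes> 1"
    and "\<sigma> (tet_x 2 3) = sl2_y \<otimes> 1"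
    and "\<sigma> (tet_x 3 1) = sl2_z \<otimes> 1"
    and "\<sigma> (tet_x 0 3) = sl2_y \<otimes> t_A + sl2_z \<otimes> (t_A - 1)"
    and "\<sigma> (tet_x 0 1) = sl2_z \<otimes> t'_A + sl2_x \<otimes> (t'_A - 1)"
    and "\<sigma> (tet_x 0 2) = sl2_x \<otimes> t''_A + sl2_y \<otimes> (t''_A - 1)"
  shows "family_basis loop_scale A_ud (\<sigma> ` tet_X 1 2 \<inter> Onsager) \<and>
         family_basis loop_scale B_ud (\<sigma> ` tet_X 3 0 \<inter> Onsager) \<and>
         family_basis loop_scale (\<lambda>i. \<psi>_ud (i + 1)) (\<sigma> ` tet_X 0 1 \<inter> Onsager)"
proof (intro conjI)
  interpret \<sigma>: Vector_Spaces.linear tet_scale loop_scale \<sigma>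
    using assms(1) by (simp add: lie_iso_def)
  have x12: "\<sigma> (tet_x 1 2) = onsager_A" and x03: "\<sigma> (tet_x 0 3) = onsager_B"
    using assms by (simp_all add: onsager_A_def onsager_B_def)
  have x30: "\<sigma> (tet_x 3 0) = - onsager_B"
    using tet_x_swap[of 0 3, where ?'a = 'a] x03 by (simp add: \<sigma>.neg)
  have x01: "\<sigma> (tet_x 0 1) = onsager_psi \<lhd> (t'_A - 1)"
    using t'_A_mult_t[where ?'a = 'a] unfolding assms
    by (simp add: sl2_eq_iff sl2_xyz_tens onsager_coords algebra_simps)

  have mem: "onsager_A \<lhd> (- t_A) ^ i \<in> (Onsager :: 'a loop set)"
    "onsager_B \<lhd> (- t_A) ^ i \<in> (Onsager :: 'a loop set)"
    "onsager_psi \<lhd> (- t_A) ^ i \<in> (Onsager :: 'a loop set)" for i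
    using Onsager_families[of i, where ?'a = 'a] by simp_all

  \<comment> \<open>In all three cases the opposite generator (B, A and y in turn) has h-coefficient
    -1 and a vanishing e- or f-coefficient, so \<open>norm\<close> holds.\<close>
  have "\<sigma> ` tet_X 1 2 = {v. loop_br onsager_A v = 0}"
    using image_tet_X[OF assms(1), of 1 2 0 3] by (simp add: x12 x03 onsager_coords)
  moreover have "A_ud = (\<lambda>i. onsager_A \<lhd> (- t_A) ^ i :: 'a loop)"
    by (simp add: fun_eq_iff A_ud_def onsager_A_def loop_act_tens)
  moreover have "family_basis loop_scale (\<lambda>i. onsager_A \<lhd> (- t_A) ^ i)
      ({v. loop_br onsager_A v = 0} \<inter> Onsager :: 'a loop set)"
    by (rule family_basis_centralizer[where g = "\<lambda>v. - h_coeff v"])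
      (auto simp: onsager_coords mem[unfolded onsager_coords]
        intro: h_coeff_centralizer Alg_poly_uminus Onsager_coeff_Alg_poly)
  ultimately show "family_basis loop_scale A_ud (\<sigma> ` tet_X 1 2 \<inter> Onsager)" by simp

  have "\<sigma> ` tet_X 3 0 = {v. loop_br (- onsager_B) v = 0}"
    using image_tet_X[OF assms(1), of 3 0 1 2] by (simp add: x12 x30 onsager_coords)
  moreover have "B_ud = (\<lambda>i. (- onsager_B) \<lhd> (- t_A) ^ i :: 'a loop)"
    by (simp add: fun_eq_iff B_ud_def onsager_B_def)
  moreover have "family_basis loop_scale (\<lambda>i. (- onsager_B) \<lhd> (- t_A) ^ i)
      ({v. loop_br (- onsager_B) v = 0} \<inter> Onsager :: 'a loop set)"
  \<comment> \<open>The multiplier carries no sign because -B has h-coefficient 1.\<close>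
  proof (rule family_basis_centralizer[where g = h_coeff])
    fix v :: "'a loop" assume "loop_br (- onsager_B) v = 0"
    then show "v = (- onsager_B) \<lhd> h_coeff v"
      using h_coeff_centralizer[of onsager_B v]
      by (simp add: onsager_coords sl2_br_uminus_left loop_act_uminus_left) (simp add: sl2_eq_iff)
  next
    show "(- onsager_B) \<lhd> (- t_A) ^ i \<in> (Onsager :: 'a loop set)" for i
      by (simp add: loop_act_uminus_left loop.subspace_neg[OF subspace_Onsager] mem)
  qed (auto simp: onsager_coords intro: Onsager_coeff_Alg_poly)
  ultimately show "family_basis loop_scale B_ud (\<sigma> ` tet_X 3 0 \<inter> Onsager)" by simp

  \<comment> \<open>The image of \<open>tet_x 0 1\<close> is psi times the unit t' - 1; multiplying
    by -t undoes this, so both have the same centralizer.\<close>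
  have "loop_br (onsager_psi \<lhd> (t'_A - 1)) v = 0 \<longleftrightarrow> loop_br onsager_psi v = 0" for v :: "'a loop"
  proof -
    have "loop_br onsager_psi v = - (loop_br (onsager_psi \<lhd> (t'_A - 1)) v \<lhd> t_A)"
      using t'_A_mult_t[where ?'a = 'a]
      by (simp add: sl2_br_act_left loop_act_act) (simp add: sl2_eq_iff)
    moreover have "0 \<lhd> a = (0 :: 'a loop)" for a by (simp add: sl2_eq_iff)
    ultimately show ?thesis by (auto simp: sl2_br_act_left)
  qed
  moreover have "\<sigma> ` tet_X 0 1 = {v. loop_br (onsager_psi \<lhd> (t'_A - 1)) v = 0}"
    using image_tet_X[OF assms(1), of 0 1 2 3] by (simp add: x01 assms(3) sl2_xyz_tens)
  \<comment> \<open>At index \<open>i + 1\<close> the integer exponent is \<open>i\<close>, so the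
    power is an ordinary one.\<close>
  moreover have "(\<lambda>i. \<psi>_ud (i + 1)) = (\<lambda>i. onsager_psi \<lhd> (- t_A) ^ i :: 'a loop)"
    by (simp add: fun_eq_iff \<psi>_ud_def onsager_psi_def minus_t_powi_of_nat)
  moreover have "family_basis loop_scale (\<lambda>i. onsager_psi \<lhd> (- t_A) ^ i)
      ({v. loop_br onsager_psi v = 0} \<inter> Onsager :: 'a loop set)"
    by (rule family_basis_centralizer[where g = "\<lambda>v. const_A (1/2) * e_coeff v"])
      (auto simp: onsager_coords mem[unfolded onsager_coords] mult.left_commute two_const_half
        intro: e_coeff_centralizer Alg_poly_scale Onsager_coeff_Alg_poly)
  ultimately show "family_basis loop_scale (\<lambda>i. \<psi>_ud (i + 1)) (\<sigma> ` tet_X 0 1 \<inter> Onsager)" by simp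
qed

end
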